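(* Let $G=(V,E)$ be a finite graph with $n=|V|$ vertices, and let $d_v$ denote the degree of vertex $v$. Then, as an identity of rational functions in $a_0,a_1,a_2$, $$M_G(a_0,a_1,a_2)=a_0^{|E|-n}\sum_{M\in\mathcal{M}(G)}(a_0a_2-a_1^2)^{|M|}\prod_{v\notin V(M)}(a_0+d_va_1).$$
   Context: Each edge of $G$ is regarded as consisting of two half-edges, one at each endpoint. A half-edge configuration is a choice of a set of half-edges such that every vertex of $G$ is incident to at most one chosen half-edge (an edge both of whose halves are chosen counts as a chosen edge, so each vertex is incident to at most one chosen edge or half-edge). For a configuration $C$, let $C_0$, $C_1$, $C_2$ be the number of edges of $G$ of which $0$, exactly $1$, respectively $2$ halves are chosen. Define $M_G(a_0,a_1,a_2)=\sum_C a_0^{C_0}a_1^{C_1}a_2^{C_2}$, summing over all half-edge configurations. $\mathcal{M}(G)$ is the set of matchings of $G$ (including the empty one), and $V(M)$ is the set of vertices covered by the matching $M$. *)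

theory Defs
  imports "HOL-Computational_Algebra.Computational_Algebra"
begin

(* Finite loopless graphs, possibly with parallel edges: ends e is the set of the two
   endpoints of the edge e.  A simple graph whose edges are two-element vertex sets is the
   case where ends is the identity. *)
locale finite_graph =
  fixes V :: "'v set" and E :: "'e set" and ends :: "'e \<Rightarrow> 'v set"
  assumes finite_V: "finite V"
    and finite_E: "finite E"
    and ends_subset: "e \<in> E \<Longrightarrow> ends e \<subseteq> V"
    and card_ends: "e \<in> E \<Longrightarrow> card (ends e) = 2"

definition vertex_degree :: "'e set \<Rightarrow> ('e \<Rightarrow> 'v set) \<Rightarrow> 'v \<Rightarrow> nat" where
  "vertex_degree E ends v = card {e \<in> E. v \<in> ends e}"

definition matchings :: "'e set \<Rightarrow> ('e \<Rightarrow> 'v set) \<Rightarrow> 'e set set" where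
  "matchings E ends = {M. M \<subseteq> E \<and> (\<forall>e\<in>M. \<forall>f\<in>M. e \<noteq> f \<longrightarrow> ends e \<inter> ends f = {})}"

definition covered :: "('e \<Rightarrow> 'v set) \<Rightarrow> 'e set \<Rightarrow> 'v set" where
  "covered ends M = (\<Union>e\<in>M. ends e)"

(* The pair (e, v) is the half of the edge e at its endpoint v. *)
definition half_edges :: "'e set \<Rightarrow> ('e \<Rightarrow> 'v set) \<Rightarrow> ('e \<times> 'v) set" where
  "half_edges E ends = {(e, v). e \<in> E \<and> v \<in> ends e}"

definition configurations ::
  "'v set \<Rightarrow> 'e set \<Rightarrow> ('e \<Rightarrow> 'v set) \<Rightarrow> ('e \<times> 'v) set set" where
  "configurations V E ends =
     {C. C \<subseteq> half_edges E ends \<and> (\<forall>v\<in>V. card {h \<in> C. snd h = v} \<le> 1)}"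

definition num_edges_with :: "'e set \<Rightarrow> ('e \<times> 'v) set \<Rightarrow> nat \<Rightarrow> nat" where
  "num_edges_with E C i = card {e \<in> E. card {h \<in> C. fst h = e} = i}"

definition M_poly ::
  "'v set \<Rightarrow> 'e set \<Rightarrow> ('e \<Rightarrow> 'v set) \<Rightarrow> 'a \<Rightarrow> 'a \<Rightarrow> 'a \<Rightarrow> 'a::comm_semiring_1" where
  "M_poly V E ends a0 a1 a2 =
     (\<Sum>C\<in>configurations V E ends.
        a0 ^ num_edges_with E C 0 * a1 ^ num_edges_with E C 1 * a2 ^ num_edges_with E C 2)"

(* Rational functions in three indeterminates are the fraction field of the iterated
   polynomial ring k[A0][A1][A2]; A0 is the innermost indeterminate. *)
type_synonym 'k ratfun3 = "'k poly poly poly fract"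

definition A0 :: "'k::idom ratfun3" where
  "A0 = Fract [:[:[:0, 1:]:]:] 1"

definition A1 :: "'k::idom ratfun3" where
  "A1 = Fract [:[:0, 1:]:] 1"

definition A2 :: "'k::idom ratfun3" where
  "A2 = Fract [:0, 1:] 1"

end

theory Submission
  imports Defs
begin

text \<open>
  Expanding \<open>\<Prod>v\<notin>V(M). (a\<^sub>0 + d\<^sub>v a\<^sub>1)\<close> lets every uncovered vertex choose one of its half-edges or
  none. Adding both halves of the edges of \<open>M\<close> turns such a choice into a configuration \<open>C\<close>
  together with a subset \<open>M\<close> of the edges of which \<open>C\<close> contains both halves. For a fixed \<open>C\<close>, the
  binomial theorem sums \<open>(a\<^sub>0 a\<^sub>2 - a\<^sub>1\<^sup>2)\<^sup>k (a\<^sub>1\<^sup>2)\<^sup>l\<close>, \<open>k + l = C\<^sub>2\<close>, over these subsets to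
  \<open>(a\<^sub>0 a\<^sub>2)\<close> to the power \<open>C\<^sub>2\<close>. The exponents of \<open>a\<^sub>0\<close> agree because \<open>|C| = C\<^sub>1 + 2 C\<^sub>2\<close> and
  \<open>|E| = C\<^sub>0 + C\<^sub>1 + C\<^sub>2\<close>.
\<close>

section \<open>Choices of half-edges, and a binomial sum over subsets\<close>

text \<open>These index the terms of the expanded product over \<open>U\<close>: injectivity of
  \<open>snd\<close> lets each vertex of \<open>U\<close> pick at most one of its half-edges. The
  set \<open>U\<close> varies so that induction on it is possible.\<close>

definition partial_choices :: "'e set \<Rightarrow> ('e \<Rightarrow> 'v set) \<Rightarrow> 'v set \<Rightarrow> ('e \<times> 'v) set set" where
  "partial_choices E ends U =
     {D. D \<subseteq> half_edges E ends \<and> snd ` D \<subseteq> U \<and> inj_on snd D}"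

definition double_edges :: "'e set \<Rightarrow> ('e \<Rightarrow> 'v set) \<Rightarrow> ('e \<times> 'v) set \<Rightarrow> 'e set" where
  "double_edges E ends C = {e \<in> E. half_edges {e} ends \<subseteq> C}"

text \<open>This is the binomial theorem before subsets of equal size are collected. The induction
  splits the subsets of \<open>insert s S\<close> by whether they contain \<open>s\<close>.\<close>

lemma sum_Pow_power:
  fixes x y :: "'a::comm_semiring_1"
  assumes "finite S"
  shows "(\<Sum>M\<in>Pow S. x ^ card M * y ^ (card S - card M)) = (x + y) ^ card S"
  using assms
proof induction
  case (insert s S)
  have inj: "inj_on (insert s) (Pow S)" and disj: "Pow S \<inter> insert s ` Pow S = {}"
    using insert.hyps by (auto simp: inj_on_def)
  have sub: "card M \<le> card S \<and> finite M \<and> s \<notin> M" if "M \<in> Pow S" for M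
    using that insert.hyps by (auto intro: card_mono finite_subset)
  have "(\<Sum>M\<in>Pow (insert s S). x ^ card M * y ^ (card (insert s S) - card M)) =
      (\<Sum>M\<in>Pow S. x ^ card M * y ^ (Suc (card S) - card M)) +
      (\<Sum>M\<in>Pow S. x ^ card (insert s M) * y ^ (Suc (card S) - card (insert s M)))"
    using insert.hyps inj disj
    by (simp add: Pow_insert sum.union_disjoint sum.reindex)
  also have "\<dots> = (\<Sum>M\<in>Pow S. y * (x ^ card M * y ^ (card S - card M))) +
      (\<Sum>M\<in>Pow S. x * (x ^ card M * y ^ (card S - card M)))"
    using sub by (intro arg_cong2[where f = "(+)"] sum.cong) (auto simp: Suc_diff_le mult_ac)
  also have "\<dots> = (x + y) ^ card (insert s S)"
    using insert by (simp add: sum_distrib_left[symmetric] algebra_simps)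
  finally show ?case .
qed simp

section \<open>Half-edges and configurations\<close>

context finite_graph
begin

lemma finite_half_edges: "finite (half_edges E ends)"
proof (rule finite_subset)
  show "half_edges E ends \<subseteq> E \<times> V"
    using ends_subset by (fastforce simp: half_edges_def)
qed (simp add: finite_E finite_V)

lemma card_half_edges:
  assumes "M \<subseteq> E"
  shows "card (half_edges M ends) = 2 * card M"
proof -
  have "half_edges M ends = Sigma M ends"
    by (auto simp: half_edges_def)
  moreover have "finite (ends e)" if "e \<in> M" for e
    using that assms ends_subset finite_V finite_subset by blast
  ultimately show ?thesis
    using assms finite_subset[OF assms finite_E] card_ends by (simp add: subset_iff)
qed

lemma finite_partial_choices: "finite (partial_choices E ends U)"
  by (rule finite_subset[of _ "Pow (half_edges E ends)"])
    (auto simp: partial_choices_def finite_half_edges)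

lemma configurations_eq_partial_choices: "configurations V E ends = partial_choices E ends V"
proof -
  have "(\<forall>v\<in>V. card {h \<in> C. snd h = v} \<le> 1) \<longleftrightarrow> snd ` C \<subseteq> V \<and> inj_on snd C"
    if C: "C \<subseteq> half_edges E ends" for C
  proof -
    \<comment> \<open>Finiteness rules out the default value 0 of \<open>card\<close>, so the bound
      1 really means at most one half-edge at \<open>v\<close>.\<close>
    have "finite {h \<in> C. snd h = v}" for v
      using C finite_half_edges by (auto intro: finite_subset)
    moreover have "snd ` C \<subseteq> V"
      using C ends_subset by (fastforce simp: half_edges_def)
    ultimately show ?thesis
      by (fastforce simp: card_le_Suc0_iff_eq inj_on_def)
  qed
  then show ?thesis
    by (auto simp: configurations_def partial_choices_def)
qed

section \<open>Expansion of the product over vertices\<close>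

text \<open>The new vertex \<open>u\<close> either picks nothing or picks exactly one incident edge;
  removing that half-edge leaves a choice on \<open>U\<close>.\<close>

lemma partial_choices_insert:
  assumes "u \<notin> U"
  shows "partial_choices E ends (insert u U) = partial_choices E ends U \<union>
    (\<lambda>(e, D). insert (e, u) D) ` ({e \<in> E. u \<in> ends e} \<times> partial_choices E ends U)"
    (is "?L = ?A \<union> ?B")
proof
  show "?L \<subseteq> ?A \<union> ?B"
  proof
    fix D assume D: "D \<in> ?L"
    show "D \<in> ?A \<union> ?B"
    proof (cases "u \<in> snd ` D")
      case False
      with D show ?thesis by (auto simp: partial_choices_def)
    next
      case True
      then obtain e where e: "(e, u) \<in> D" by force
      have "D - {(e, u)} \<in> ?A"
      proof -
        have "inj_on snd D" "D \<subseteq> half_edges E ends" "snd ` D \<subseteq> insert u U"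
          using D by (auto simp: partial_choices_def)
        moreover from this(1) have "snd ` (D - {(e, u)}) = snd ` D - {u}"
          using e inj_on_image_set_diff[of snd D D "{(e, u)}"] by simp
        ultimately show ?thesis
          by (auto simp: partial_choices_def intro: inj_on_diff)
      qed
      moreover have "D = insert (e, u) (D - {(e, u)})" "e \<in> E" "u \<in> ends e"
        using D e by (auto simp: partial_choices_def half_edges_def)
      ultimately show ?thesis
        by (intro UnI2 image_eqI[where x = "(e, D - {(e, u)})"]) auto
    qed
  qed
  show "?A \<union> ?B \<subseteq> ?L"
    using assms by (auto simp: partial_choices_def half_edges_def inj_on_def)
qed

text \<open>By induction on \<open>U\<close>: a new vertex contributes a factor \<open>a\<close> if
  it picks nothing and a factor \<open>b\<close> for each of its incident edges.\<close>

lemma sum_partial_choices: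
  fixes a b :: "'a::comm_semiring_1"
  assumes "finite U"
  shows "(\<Sum>D\<in>partial_choices E ends U. a ^ (card U - card D) * b ^ card D) =
    (\<Prod>v\<in>U. a + of_nat (vertex_degree E ends v) * b)"
  using assms
proof induction
  case empty
  have "partial_choices E ends {} = {{}}"
    by (auto simp: partial_choices_def)
  then show ?case by simp
next
  case (insert u U)
  let ?P = "partial_choices E ends U" and ?F = "{e \<in> E. u \<in> ends e}"
  let ?w = "\<lambda>D. a ^ (card U - card D) * b ^ card D"
  \<comment> \<open>The bound keeps the subtraction in the exponent from truncating; the absence of
    half-edges at \<open>u\<close> makes insertion injective and separates the two kinds of
    choices.\<close>
  have P: "finite D \<and> card D \<le> card U \<and> (\<forall>e. (e, u) \<notin> D)" if "D \<in> ?P" for D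
  proof -
    have D: "D \<subseteq> half_edges E ends" "snd ` D \<subseteq> U" "inj_on snd D"
      using that by (auto simp: partial_choices_def)
    have "finite D"
      using D(1) finite_half_edges by (rule finite_subset)
    moreover have "card D \<le> card U"
      using D(3,2) insert.hyps(1) by (rule card_inj_on_le)
    ultimately show ?thesis
      using D(2) insert.hyps(2) by auto
  qed
  have inj: "inj_on (\<lambda>(e, D). insert (e, u) D) (?F \<times> ?P)"
  proof (rule inj_onI, clarify)
    fix e D e' D'
    assume "D \<in> ?P" "D' \<in> ?P" and eq: "insert (e, u) D = insert (e', u) D'"
    then have "(e, u) \<notin> D" "(e, u) \<notin> D'" "(e', u) \<notin> D'"
      using P by auto
    then show "e = e' \<and> D = D'"
      using eq by (metis fst_conv insert_ident insertE insertI1)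
  qed
  have disj: "?P \<inter> (\<lambda>(e, D). insert (e, u) D) ` (?F \<times> ?P) = {}"
    using P by blast
  have "(\<Sum>D\<in>partial_choices E ends (insert u U). a ^ (card (insert u U) - card D) * b ^ card D) =
      (\<Sum>D\<in>?P. a ^ (Suc (card U) - card D) * b ^ card D) +
      (\<Sum>(e, D)\<in>?F \<times> ?P. a ^ (Suc (card U) - card (insert (e, u) D)) * b ^ card (insert (e, u) D))"
    using insert.hyps inj disj finite_E
    by (simp add: partial_choices_insert finite_partial_choices sum.union_disjoint sum.reindex
        case_prod_unfold)
  also have "\<dots> = (\<Sum>D\<in>?P. a * ?w D) + (\<Sum>(e, D)\<in>?F \<times> ?P. b * ?w D)"
    using P by (intro arg_cong2[where f = "(+)"] sum.cong) (auto simp: Suc_diff_le mult_ac)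
  also have "\<dots> = (a + of_nat (vertex_degree E ends u) * b) * (\<Sum>D\<in>?P. ?w D)"
    by (simp add: sum.cartesian_product[symmetric] sum_distrib_left[symmetric] vertex_degree_def
        algebra_simps)
  finally show ?case
    using insert by simp
qed

section \<open>Exchange of the sums over matchings and configurations\<close>

lemma inj_on_snd_half_edges:
  assumes "M \<in> matchings E ends"
  shows "inj_on snd (half_edges M ends)"
  using assms by (fastforce simp: matchings_def half_edges_def inj_on_def)

lemma snd_half_edges: "snd ` half_edges M ends = covered ends M"
  by (force simp: half_edges_def covered_def)

text \<open>The map from \<open>(M, D)\<close> to \<open>(D \<union> half_edges M ends, M)\<close>
  is a bijection, with inverse \<open>(C, M)\<close> to
  \<open>(M, C - half_edges M ends)\<close>.\<close>

lemma sum_matching_choices: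
  fixes f :: "'e set \<Rightarrow> ('e \<times> 'v) set \<Rightarrow> 'a::comm_monoid_add"
  shows "(\<Sum>M\<in>matchings E ends. \<Sum>D\<in>partial_choices E ends (V - covered ends M).
      f M (D \<union> half_edges M ends)) =
    (\<Sum>C\<in>configurations V E ends. \<Sum>M\<in>Pow (double_edges E ends C). f M C)"
proof -
  have fin: "finite (matchings E ends)" "finite (configurations V E ends)"
    "finite (Pow (double_edges E ends C))" for C
    using finite_E finite_partial_choices
    by (auto simp: matchings_def configurations_eq_partial_choices double_edges_def)
  have fwd: "D \<union> half_edges M ends \<in> partial_choices E ends V"
      "M \<subseteq> double_edges E ends (D \<union> half_edges M ends)"
      "(D \<union> half_edges M ends) - half_edges M ends = D"
    if M: "M \<in> matchings E ends" and D: "D \<in> partial_choices E ends (V - covered ends M)" for M D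
  proof -
    have ME: "M \<subseteq> E" using M by (simp add: matchings_def)
    \<comment> \<open>As \<open>D\<close> avoids the covered vertices, the union still has at most
      one half-edge at each vertex, and \<open>D\<close> can be recovered from it.\<close>
    have sep: "snd ` D \<inter> snd ` half_edges M ends = {}"
      using D by (auto simp: partial_choices_def snd_half_edges)
    have "inj_on snd (D \<union> half_edges M ends)"
      using D sep inj_on_snd_half_edges[OF M] by (auto simp: partial_choices_def inj_on_Un)
    moreover have "snd ` half_edges M ends \<subseteq> V"
      using ME ends_subset by (fastforce simp: half_edges_def)
    moreover have "half_edges M ends \<subseteq> half_edges E ends"
      using ME by (auto simp: half_edges_def)
    ultimately show "D \<union> half_edges M ends \<in> partial_choices E ends V"
      using D by (auto simp: partial_choices_def)
    show "M \<subseteq> double_edges E ends (D \<union> half_edges M ends)"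
      using ME by (auto simp: double_edges_def half_edges_def)
    show "(D \<union> half_edges M ends) - half_edges M ends = D"
      using sep by auto
  qed
  have bwd: "M \<in> matchings E ends"
      "C - half_edges M ends \<in> partial_choices E ends (V - covered ends M)"
      "(C - half_edges M ends) \<union> half_edges M ends = C"
    if C: "C \<in> partial_choices E ends V" and M: "M \<subseteq> double_edges E ends C" for M C
  proof -
    have sub: "half_edges M ends \<subseteq> C"
      using M by (auto simp: double_edges_def half_edges_def)
    then show "(C - half_edges M ends) \<union> half_edges M ends = C" by auto
    have inj: "inj_on snd C" using C by (simp add: partial_choices_def)
    \<comment> \<open>A common end of \<open>e\<close> and \<open>f\<close> would carry two
      half-edges of \<open>C\<close>.\<close>
    have "ends e \<inter> ends f = {}" if "e \<in> M" "f \<in> M" "e \<noteq> f" for e f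
    proof -
      have "(e, v) \<in> C" "(f, v) \<in> C" if "v \<in> ends e \<inter> ends f" for v
        using that sub \<open>e \<in> M\<close> \<open>f \<in> M\<close> by (auto simp: half_edges_def)
      then show ?thesis
        using inj \<open>e \<noteq> f\<close> by (fastforce simp: inj_on_def)
    qed
    then show "M \<in> matchings E ends"
      using M by (auto simp: matchings_def double_edges_def)
    \<comment> \<open>At a covered vertex the only half-edge of \<open>C\<close> is the one
      belonging to \<open>M\<close>, and it has been removed.\<close>
    have "snd ` (C - half_edges M ends) \<inter> covered ends M = {}"
      using inj sub by (auto simp: snd_half_edges[symmetric] inj_on_def)
    then show "C - half_edges M ends \<in> partial_choices E ends (V - covered ends M)"
      using C by (auto simp: partial_choices_def intro: inj_on_diff)
  qed
  show ?thesis
    unfolding sum.Sigma[OF fin(1) ballI[OF finite_partial_choices]]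
      sum.Sigma[OF fin(2) ballI[OF fin(3)]]
  proof (rule sum.reindex_bij_witness[where
        j = "\<lambda>(M, D). (D \<union> half_edges M ends, M)" and i = "\<lambda>(C, M). (M, C - half_edges M ends)"],
      goal_cases)
    case (1 x)
    then obtain M D where "x = (M, D)" "M \<in> matchings E ends"
      "D \<in> partial_choices E ends (V - covered ends M)" by blast
    with fwd(3) show ?case by simp
  next
    case (2 x)
    then obtain M D where "x = (M, D)" "M \<in> matchings E ends"
      "D \<in> partial_choices E ends (V - covered ends M)" by blast
    with fwd(1,2) show ?case by (simp add: configurations_eq_partial_choices)
  next
    case (3 y)
    then obtain C M where "y = (C, M)" "C \<in> partial_choices E ends V"
      "M \<subseteq> double_edges E ends C" by (auto simp: configurations_eq_partial_choices)
    with bwd(3) show ?case by simp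
  next
    case (4 y)
    then obtain C M where "y = (C, M)" "C \<in> partial_choices E ends V"
      "M \<subseteq> double_edges E ends C" by (auto simp: configurations_eq_partial_choices)
    with bwd(1,2) show ?case by simp
  next
    case (5 x)
    then obtain M D where "x = (M, D)" "M \<in> matchings E ends"
      "D \<in> partial_choices E ends (V - covered ends M)" by blast
    then show ?case by simp
  qed
qed

section \<open>Edge counts of a configuration\<close>

lemma edge_counts:
  assumes "C \<in> configurations V E ends"
  shows "card C = num_edges_with E C 1 + 2 * num_edges_with E C 2"
    and "card E = num_edges_with E C 0 + num_edges_with E C 1 + num_edges_with E C 2"
    and "card (double_edges E ends C) = num_edges_with E C 2"
proof -
  let ?c = "\<lambda>e. card {h \<in> C. fst h = e}"
  have CH: "C \<subseteq> half_edges E ends"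
    using assms by (simp add: configurations_def)
  then have finC: "finite C"
    using finite_half_edges finite_subset by blast
  have sub: "{h \<in> C. fst h = e} \<subseteq> half_edges {e} ends" for e
    using CH by (auto simp: half_edges_def)
  have fin: "finite (half_edges {e} ends)" and card2: "card (half_edges {e} ends) = 2" if "e \<in> E" for e
    using that card_half_edges[of "{e}"] by (auto intro: card_ge_0_finite)
  have c_cases: "?c e = 0 \<or> ?c e = 1 \<or> ?c e = 2" if "e \<in> E" for e
    using card_mono[OF fin sub, OF that] card2[OF that] by linarith
  \<comment> \<open>The half-edges in \<open>C\<close> are grouped by their edge; each edge
    contributes 0, 1 or 2.\<close>
  have "card C = (\<Sum>e\<in>E. ?c e)"
    using sum.group[OF finC finite_E, of fst "\<lambda>_. 1::nat"] CH by (force simp: half_edges_def)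
  also have "\<dots> = (\<Sum>e\<in>E. (if ?c e = 1 then 1 else 0) + 2 * (if ?c e = 2 then 1 else 0))"
    using c_cases by (intro sum.cong) auto
  also have "\<dots> = num_edges_with E C 1 + 2 * num_edges_with E C 2"
    using finite_E by (simp add: sum.distrib sum_distrib_left[symmetric] num_edges_with_def
        sum.If_cases Int_def)
  finally show "card C = num_edges_with E C 1 + 2 * num_edges_with E C 2" .
  have "card E = (\<Sum>e\<in>E. (if ?c e = 0 then 1 else 0) + (if ?c e = 1 then 1 else 0) +
      (if ?c e = 2 then 1 else 0))"
    unfolding card_eq_sum[of E] by (rule sum.cong, simp, drule c_cases, auto)
  also have "\<dots> = num_edges_with E C 0 + num_edges_with E C 1 + num_edges_with E C 2"
    using finite_E by (simp add: sum.distrib num_edges_with_def sum.If_cases Int_def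
        del: card_0_eq card_eq_0_iff)
  finally show "card E = num_edges_with E C 0 + num_edges_with E C 1 + num_edges_with E C 2" .
  have "half_edges {e} ends \<subseteq> C \<longleftrightarrow> ?c e = 2" if "e \<in> E" for e
  proof
    assume "half_edges {e} ends \<subseteq> C"
    then have "{h \<in> C. fst h = e} = half_edges {e} ends"
      using sub by (auto simp: half_edges_def)
    then show "?c e = 2" by (simp add: card2 that)
  next
    assume "?c e = 2"
    then have "{h \<in> C. fst h = e} = half_edges {e} ends"
      by (intro card_subset_eq fin sub) (simp_all add: card2 that)
    then show "half_edges {e} ends \<subseteq> C" by auto
  qed
  then show "card (double_edges E ends C) = num_edges_with E C 2"
    unfolding double_edges_def num_edges_with_def by (intro arg_cong[where f = card]) auto
qed

lemma card_configuration_le: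
  assumes "C \<in> configurations V E ends"
  shows "card C \<le> card V"
  using assms finite_V
  by (auto simp: configurations_eq_partial_choices partial_choices_def intro: card_inj_on_le)

section \<open>The identity over a field and for rational functions\<close>

text \<open>The exponent of \<open>a0\<close> in front may be negative; \<open>a0 \<noteq> 0\<close>
  allows it to be added to the other exponents of \<open>a0\<close>.\<close>

theorem M_poly_eq_matching_sum:
  fixes a0 a1 a2 :: "'a::field"
  assumes "a0 \<noteq> 0"
  shows "M_poly V E ends a0 a1 a2 =
    a0 powi (int (card E) - int (card V)) *
    (\<Sum>M\<in>matchings E ends. (a0 * a2 - a1 ^ 2) ^ card M *
       (\<Prod>v\<in>V - covered ends M. a0 + of_nat (vertex_degree E ends v) * a1))"
proof -
  let ?q = "a0 * a2 - a1 ^ 2"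
  \<comment> \<open>The weight of \<open>(M, D)\<close> is rewritten in terms of \<open>M\<close>
    and the union \<open>C\<close>, using \<open>card C = card D + 2 * card M\<close>, so that the
    sums can be exchanged.\<close>
  let ?f = "\<lambda>M C. ?q ^ card M * (a0 ^ (card V - card C) * a1 ^ (card C - 2 * card M))"
  have weight: "?q ^ card M * (a0 ^ (card (V - covered ends M) - card D) * a1 ^ card D) =
      ?f M (D \<union> half_edges M ends)"
    if M: "M \<in> matchings E ends" and D: "D \<in> partial_choices E ends (V - covered ends M)" for M D
  proof -
    have ME: "M \<subseteq> E" using M by (simp add: matchings_def)
    have H: "half_edges M ends \<subseteq> half_edges E ends"
      using ME by (auto simp: half_edges_def)
    have "D \<inter> half_edges M ends = {}"
      using D by (auto simp: partial_choices_def snd_half_edges[symmetric])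
    moreover have "finite D" "finite (half_edges M ends)"
      using D H finite_half_edges by (auto simp: partial_choices_def intro: finite_subset)
    ultimately have card_Un: "card (D \<union> half_edges M ends) = card D + 2 * card M"
      by (simp add: card_Un_disjoint card_half_edges[OF ME])
    have "covered ends M \<subseteq> V"
      using ME ends_subset by (fastforce simp: covered_def)
    moreover have "card (covered ends M) = 2 * card M"
      using card_image[OF inj_on_snd_half_edges[OF M]]
      by (simp add: snd_half_edges card_half_edges[OF ME])
    ultimately have "card (V - covered ends M) = card V - 2 * card M"
      using finite_V by (simp add: card_Diff_subset finite_subset)
    then show ?thesis
      by (simp add: card_Un add.commute)
  qed
  have config: "a0 powi (int (card E) - int (card V)) *
      (\<Sum>M\<in>Pow (double_edges E ends C). ?f M C) =
      a0 ^ num_edges_with E C 0 * a1 ^ num_edges_with E C 1 * a2 ^ num_edges_with E C 2"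
    if C: "C \<in> configurations V E ends" for C
  proof -
    let ?S = "double_edges E ends C"
    let ?n0 = "num_edges_with E C 0" and ?n1 = "num_edges_with E C 1"
      and ?n2 = "num_edges_with E C 2"
    note counts = edge_counts[OF C]
    have finS: "finite ?S" using finite_E by (simp add: double_edges_def)
    \<comment> \<open>Each edge of \<open>double_edges E ends C\<close> outside \<open>M\<close>
      supplies a factor \<open>a1\<^sup>2\<close>, which puts the sum over \<open>M\<close> into
      binomial form.\<close>
    have "?f M C = a0 ^ (card V - card C) * a1 ^ ?n1 * (?q ^ card M * (a1\<^sup>2) ^ (card ?S - card M))"
      if "M \<in> Pow ?S" for M
    proof -
      have "card M \<le> ?n2" using that finS counts(3) by (metis PowD card_mono)
      then have "card C - 2 * card M = ?n1 + 2 * (?n2 - card M)"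
        using counts(1) by simp
      then show ?thesis
        by (simp add: counts(3) power_add power_mult mult_ac)
    qed
    then have "(\<Sum>M\<in>Pow ?S. ?f M C) = a0 ^ (card V - card C) * a1 ^ ?n1 * (?q + a1\<^sup>2) ^ card ?S"
      unfolding sum_Pow_power[OF finS, symmetric] sum_distrib_left by (rule sum.cong[OF refl])
    \<comment> \<open>Here \<open>?q + a1\<^sup>2\<close> collapses to
      \<open>a0 * a2\<close>.\<close>
    also have "\<dots> = a0 ^ (card V - card C + ?n2) * (a1 ^ ?n1 * a2 ^ ?n2)"
      by (simp add: counts(3) power_mult_distrib power_add mult_ac)
    finally have "a0 powi (int (card E) - int (card V)) * (\<Sum>M\<in>Pow ?S. ?f M C) =
        a0 powi (int (card E) - int (card V) + int (card V - card C + ?n2)) * (a1 ^ ?n1 * a2 ^ ?n2)"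
      using power_int_add[of a0 "int (card E) - int (card V)" "int (card V - card C + ?n2)"] assms
      by (simp only: power_int_of_nat mult.assoc simp_thms)
    \<comment> \<open>Substituting \<open>card E = ?n0 + ?n1 + ?n2\<close> and
      \<open>card C = ?n1 + 2 * ?n2\<close> leaves \<open>?n0\<close>; the subtraction is exact
      since \<open>card C \<le> card V\<close>.\<close>
    also have "int (card E) - int (card V) + int (card V - card C + ?n2) = int ?n0"
      using counts(1,2) card_configuration_le[OF C] by simp
    finally show ?thesis
      by (simp add: mult_ac)
  qed
  have "(\<Sum>M\<in>matchings E ends. ?q ^ card M *
      (\<Prod>v\<in>V - covered ends M. a0 + of_nat (vertex_degree E ends v) * a1)) =
      (\<Sum>M\<in>matchings E ends. \<Sum>D\<in>partial_choices E ends (V - covered ends M).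
        ?f M (D \<union> half_edges M ends))"
    unfolding sum_partial_choices[OF finite_Diff[OF finite_V], symmetric] sum_distrib_left
    by (intro sum.cong refl weight)
  also have "\<dots> = (\<Sum>C\<in>configurations V E ends. \<Sum>M\<in>Pow (double_edges E ends C). ?f M C)"
    by (rule sum_matching_choices)
  finally show ?thesis
    by (simp only: M_poly_def sum_distrib_left[of _ _ "configurations V E ends"] config
        cong: sum.cong)
qed

end

text \<open>Rational functions form a field, so the field identity applies once the indeterminate
  \<open>A0\<close> is seen to be nonzero.\<close>

theorem theorem2p3:
  fixes V :: "'v set" and E :: "'e set" and ends :: "'e \<Rightarrow> 'v set"
  assumes "finite_graph V E ends"
  shows "M_poly V E ends A0 A1 (A2 :: 'k::idom ratfun3) =
    A0 powi (int (card E) - int (card V)) *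
    (\<Sum>M\<in>matchings E ends.
       (A0 * A2 - A1 ^ 2) ^ card M *
       (\<Prod>v\<in>V - covered ends M. A0 + of_nat (vertex_degree E ends v) * A1))"
proof (rule finite_graph.M_poly_eq_matching_sum[OF assms])
  show "(A0 :: 'k ratfun3) \<noteq> 0"
    by (simp add: A0_def Zero_fract_def eq_fract)
qed

end
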